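(* Let $A_i:\mathbb{Z}_{\ge0}\to\mathbb{R}^{n\times n}$, $i=0,\ldots,N$, be bounded and consider the stochastic system $$x(k+1)=A_0(k)x(k)+\sum_{i=1}^N\nu_i(k)A_i(k)x(k),\quad k\ge k_0,\qquad x(k_0)=x_0,\qquad(\ast)$$ where the real random signals $\nu_1(k),\ldots,\nu_N(k)$ are stationary, independent of each other and independent of the state $x(k)$. Assume that $\nu_1(k),\ldots,\nu_N(k)$ have zero mean and unit variance. The following statements are equivalent: (a) The system $(\ast)$ is uniformly exponentially mean-square stable. (b) There exist functions $P,Q:\mathbb{Z}_{\ge0}\to\mathbb{S}^n_{\succ0}$ and constants $\alpha_1,\alpha_2,\beta_1,\beta_2>0$ such that $\alpha_1I\preceq P(k)\preceq\alpha_2I$, $\beta_1I\preceq Q(k)\preceq\beta_2I$ and $$\sum_{i=0}^NA_i(k)^TP(k+1)A_i(k)-P(k)=-Q(k)$$ hold for all $k\ge0$.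
   Context: $\mathbb{S}^n_{\succ0}$ denotes the real symmetric positive definite $n\times n$ matrices; $\preceq$ is the Loewner order. Independence means that, for each $k$, the random variables $\nu_1(k),\ldots,\nu_N(k)$ and the random vector $x(k)$ are mutually independent. The system is uniformly exponentially mean-square stable if there exist $\rho\in[0,1)$ and $\beta>1$ such that $\mathbb{E}[\|x(k)\|_2^2]\le\beta\rho^{k-k_0}\mathbb{E}[\|x_0\|_2^2]$ for all $k\ge k_0$, all $k_0\ge0$ and all $x_0\in\mathbb{R}^n$. *)

theory Defs
  imports "HOL-Probability.Probability"
begin

definition posdef :: "real^'n^'n \<Rightarrow> bool" where
  "posdef X \<longleftrightarrow> transpose X = X \<and> (\<forall>v. v \<noteq> 0 \<longrightarrow> 0 < v \<bullet> (X *v v))"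

definition possemidef :: "real^'n^'n \<Rightarrow> bool" where
  "possemidef X \<longleftrightarrow> transpose X = X \<and> (\<forall>v. 0 \<le> v \<bullet> (X *v v))"

definition loewner_le :: "real^'n^'n \<Rightarrow> real^'n^'n \<Rightarrow> bool"  (infix "\<preceq>\<^sub>L" 50) where
  "X \<preceq>\<^sub>L Y \<longleftrightarrow> possemidef (Y - X)"

text \<open>Strict stationarity: the law of the whole sequence is invariant under time shifts.\<close>

definition stationary :: "'w measure \<Rightarrow> (nat \<Rightarrow> 'w \<Rightarrow> real) \<Rightarrow> bool" where
  "stationary M X \<longleftrightarrow>
     (\<forall>h. distr M (Pi\<^sub>M UNIV (\<lambda>_. borel)) (\<lambda>\<omega> k. X (k + h) \<omega>)
        = distr M (Pi\<^sub>M UNIV (\<lambda>_. borel)) (\<lambda>\<omega> k. X k \<omega>))"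

text \<open>The trajectory started at time \<open>k0\<close> in \<open>x0\<close>. It is only meaningful for times
  \<open>k \<ge> k0\<close>; it is extended by the constant \<open>x0\<close> to earlier times.\<close>

primrec state ::
  "nat \<Rightarrow> (nat \<Rightarrow> nat \<Rightarrow> real^'n^'n) \<Rightarrow> (nat \<Rightarrow> nat \<Rightarrow> 'w \<Rightarrow> real) \<Rightarrow>
   nat \<Rightarrow> real^'n \<Rightarrow> nat \<Rightarrow> 'w \<Rightarrow> real^'n" where
  "state N A \<nu> k0 x0 0 = (\<lambda>\<omega>. x0)"
| "state N A \<nu> k0 x0 (Suc k) =
     (if k0 \<le> k
      then (\<lambda>\<omega>. A 0 k *v state N A \<nu> k0 x0 k \<omega>
                + (\<Sum>i=1..N. \<nu> i k \<omega> *\<^sub>R (A i k *v state N A \<nu> k0 x0 k \<omega>)))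
      else (\<lambda>\<omega>. x0))"

lemma state_initial: "state N A \<nu> k0 x0 k0 \<omega> = x0"
  by (cases k0) auto

lemma state_step:
  "k0 \<le> k \<Longrightarrow> state N A \<nu> k0 x0 (k + 1) \<omega> =
     A 0 k *v state N A \<nu> k0 x0 k \<omega>
     + (\<Sum>i=1..N. \<nu> i k \<omega> *\<^sub>R (A i k *v state N A \<nu> k0 x0 k \<omega>))"
  by simp

text \<open>Mutual independence of real random variables \<open>Y 1, \<dots>, Y N\<close> and a random vector \<open>x\<close>.
  As \<open>indep_vars\<close> requires a common codomain type, the generated families of
  events are used directly (cf. \<open>indep_vars_def2\<close>), index \<open>0\<close> standing for \<open>x\<close>.\<close>

definition indep_with_vector ::
  "'w measure \<Rightarrow> nat \<Rightarrow> (nat \<Rightarrow> 'w \<Rightarrow> real) \<Rightarrow> ('w \<Rightarrow> real^'n) \<Rightarrow> bool" where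
  "indep_with_vector M N Y x \<longleftrightarrow>
     (\<forall>i\<in>{1..N}. Y i \<in> borel_measurable M) \<and> x \<in> borel_measurable M \<and>
     prob_space.indep_sets M
       (\<lambda>i. if i = 0 then {x -` B \<inter> space M | B. B \<in> sets borel}
            else {Y i -` B \<inter> space M | B. B \<in> sets borel}) {0..N}"

text \<open>Integrability is required explicitly because the Bochner integral of a non-integrable
  function is \<open>0\<close>.\<close>

definition unif_exp_ms_stable ::
  "'w measure \<Rightarrow> nat \<Rightarrow> (nat \<Rightarrow> nat \<Rightarrow> real^'n^'n) \<Rightarrow> (nat \<Rightarrow> nat \<Rightarrow> 'w \<Rightarrow> real) \<Rightarrow> bool" where
  "unif_exp_ms_stable M N A \<nu> \<longleftrightarrow>
     (\<exists>\<rho> \<beta> :: real. 0 \<le> \<rho> \<and> \<rho> < 1 \<and> 1 < \<beta> \<and>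
       (\<forall>k0 k x0. k0 \<le> k \<longrightarrow>
          integrable M (\<lambda>\<omega>. (norm (state N A \<nu> k0 x0 k \<omega>))\<^sup>2) \<and>
          prob_space.expectation M (\<lambda>\<omega>. (norm (state N A \<nu> k0 x0 k \<omega>))\<^sup>2)
            \<le> \<beta> * \<rho> ^ (k - k0) * prob_space.expectation M (\<lambda>\<omega>. (norm x0)\<^sup>2)))"

end

theory Submission imports Defs begin

text \<open>Independence, zero mean and unit variance kill the cross terms in the expansion of
  \<open>x(k+1)\<^sup>T X x(k+1)\<close>, so its expectation is that of \<open>x(k)\<^sup>T T\<^sub>k(X) x(k)\<close> with
  \<open>T\<^sub>k(X) = \<Sum>\<^sub>i A\<^sub>i(k)\<^sup>T X A\<^sub>i(k)\<close>. Hence a solution of the Lyapunov equation makes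
  \<open>E[x(k)\<^sup>T P(k) x(k)]\<close> contract geometrically. Conversely, under stability the quadratic forms of
  \<open>T\<^sub>k T\<^sub>k\<^sub>+\<^sub>1 \<cdots> T\<^sub>k\<^sub>+\<^sub>j\<^sub>-\<^sub>1(I)\<close>, being the second moments of the state \<open>j\<close> steps after time \<open>k\<close>,
  decay geometrically, and summing these matrices over \<open>j\<close> gives \<open>P(k)\<close> with \<open>Q(k) = I\<close>.\<close>

section \<open>Second moments under independence\<close>

text \<open>Mutual independence splits the expectation into one factor per index. For i \<noteq> j
  at least one of the two indices is positive, and its noise occurs only to the first power, so its
  zero mean annihilates the product. For i = j > 0 the noise factor is a unit second moment. The
  convention \<open>W 0 = 1\<close> lets the deterministic term of the system be treated like the
  noise terms.\<close>

lemma (in prob_space) indep_with_vector_product_moment: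
  fixes Y :: "nat \<Rightarrow> 'a \<Rightarrow> real" and x :: "'a \<Rightarrow> real^'n" and g :: "real^'n \<Rightarrow> real"
  assumes indep: "indep_with_vector M N Y x"
    and sq: "\<And>i. i \<in> {1..N} \<Longrightarrow> integrable M (\<lambda>\<omega>. (Y i \<omega>)\<^sup>2)"
    and mean: "\<And>i. i \<in> {1..N} \<Longrightarrow> expectation (Y i) = 0"
    and second: "\<And>i. i \<in> {1..N} \<Longrightarrow> expectation (\<lambda>\<omega>. (Y i \<omega>)\<^sup>2) = 1"
    and g: "g \<in> borel_measurable borel"
    and int: "integrable M (\<lambda>\<omega>. g (x \<omega>))"
    and ij: "i \<le> N" "j \<le> N"
  defines "W \<equiv> \<lambda>l \<omega>. if l = 0 then 1 else Y l \<omega>"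
  shows "integrable M (\<lambda>\<omega>. W i \<omega> * W j \<omega> * g (x \<omega>))" (is ?int)
    and "expectation (\<lambda>\<omega>. W i \<omega> * W j \<omega> * g (x \<omega>)) = (if i = j then expectation (\<lambda>\<omega>. g (x \<omega>)) else 0)"
      (is ?exp)
proof -
  have Ym: "Y l \<in> borel_measurable M" if "l \<in> {1..N}" for l
    using indep that unfolding indep_with_vector_def by blast
  have xm: "x \<in> borel_measurable M"
    using indep unfolding indep_with_vector_def by blast
  have gx: "(\<lambda>\<omega>. g (x \<omega>)) \<in> borel_measurable M"
    using g xm by measurable
  \<comment> \<open>Replacing the vector by the real variable \<open>g (x \<omega>)\<close> at index
    0 gives all variables the codomain that \<open>indep_vars\<close> needs. Independence survives
    because every event of g(x) is an event of x, namely the one for the preimage of B under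
    g.\<close>
  have pre: "indep_vars (\<lambda>_. borel) (\<lambda>l. if l = 0 then (\<lambda>\<omega>. g (x \<omega>)) else Y l) {0..N}"
    unfolding indep_vars_def2
  proof (intro conjI ballI)
    fix l assume "l \<in> {0..N}"
    then show "random_variable borel (if l = 0 then \<lambda>\<omega>. g (x \<omega>) else Y l)"
      using gx Ym by auto
  next
    have *: "indep_sets (\<lambda>i. if i = 0 then {x -` B \<inter> space M | B. B \<in> sets borel}
            else {Y i -` B \<inter> space M | B. B \<in> sets borel}) {0..N}"
      using indep unfolding indep_with_vector_def by blast
    show "indep_sets (\<lambda>l. {(if l = 0 then \<lambda>\<omega>. g (x \<omega>) else Y l) -` B \<inter> space M |B. B \<in> sets borel}) {0..N}"
    proof (rule indep_sets_mono_sets[OF *])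
      fix l :: nat
      have "\<exists>B'. (\<lambda>\<omega>. g (x \<omega>)) -` B \<inter> space M = x -` B' \<inter> space M \<and> B' \<in> sets borel"
        if "B \<in> sets borel" for B
        using measurable_sets[OF g that] by (intro exI[of _ "g -` B"]) auto
      then show "{(if l = 0 then \<lambda>\<omega>. g (x \<omega>) else Y l) -` B \<inter> space M |B. B \<in> sets borel}
        \<subseteq> (if l = 0 then {x -` B \<inter> space M | B. B \<in> sets borel}
            else {Y l -` B \<inter> space M | B. B \<in> sets borel})"
        by auto
    qed
  qed
  \<comment> \<open>\<open>f l\<close> collects the power of \<open>Y l\<close> in
    \<open>W i * W j\<close> (0, 1 or 2) into a function of a single variable and leaves index 0
    alone. The target then becomes a product of independent variables \<open>Z l\<close>.\<close>
  define f :: "nat \<Rightarrow> real \<Rightarrow> real" where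
    "f l y = (if l = 0 then y else (if l = i then y else 1) * (if l = j then y else 1))" for l y
  define Z where "Z l \<omega> = f l (if l = 0 then g (x \<omega>) else Y l \<omega>)" for l \<omega>
  have "indep_vars (\<lambda>_. borel) (\<lambda>l. f l \<circ> (if l = 0 then (\<lambda>\<omega>. g (x \<omega>)) else Y l)) {0..N}"
    by (rule indep_vars_compose[OF pre]) (simp add: f_def[abs_def])
  moreover have "(\<lambda>l. f l \<circ> (if l = 0 then (\<lambda>\<omega>. g (x \<omega>)) else Y l)) = Z"
    by (auto simp: Z_def fun_eq_iff)
  ultimately have Z: "indep_vars (\<lambda>_. borel) Z {0..N}"
    by simp
  have Y1: "integrable M (Y l)" if "l \<in> {1..N}" for l
    by (rule square_integrable_imp_integrable) (use that sq Ym in auto)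
  have intZ: "integrable M (Z l)" if "l \<in> {0..N}" for l
  proof (cases "l = 0")
    case True
    then show ?thesis using int by (simp add: Z_def[abs_def] f_def)
  next
    case False
    then show ?thesis using that Y1[of l] sq[of l]
      by (cases "l = i"; cases "l = j") (auto simp: Z_def[abs_def] f_def power2_eq_square)
  qed
  have expZ: "expectation (Z l) = (if l = i \<and> i \<noteq> j \<or> l = j \<and> i \<noteq> j then 0 else 1)"
    if "l \<in> {1..N}" for l
    using that mean[of l] second[of l]
    by (cases "l = i"; cases "l = j") (auto simp: Z_def[abs_def] f_def power2_eq_square prob_space)
  have pick: "(\<Prod>l\<in>{1..N}. if l = m then Y l \<omega> else 1) = W m \<omega>" if "m \<le> N" for m \<omega>
    using that by (auto simp: W_def prod.delta)
  have eq: "(\<Prod>l\<in>{0..N}. Z l \<omega>) = W i \<omega> * W j \<omega> * g (x \<omega>)" for \<omega>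
  proof -
    have "(\<Prod>l\<in>{0..N}. Z l \<omega>) = g (x \<omega>) *
      (\<Prod>l\<in>{1..N}. (if l = i then Y l \<omega> else 1) * (if l = j then Y l \<omega> else 1))"
      by (subst prod.atLeast_Suc_atMost) (auto simp: Z_def f_def intro!: prod.cong)
    then show ?thesis
      using pick[OF ij(1)] pick[OF ij(2)] by (simp add: prod.distrib)
  qed
  show ?int
    using indep_vars_integrable[OF _ Z intZ] by (simp add: eq)
  have "expectation (\<lambda>\<omega>. W i \<omega> * W j \<omega> * g (x \<omega>)) = (\<Prod>l\<in>{0..N}. expectation (Z l))"
    using indep_vars_lebesgue_integral[OF _ Z intZ] by (simp add: eq)
  also have "\<dots> = expectation (Z 0) * (\<Prod>l\<in>{1..N}. expectation (Z l))"
    by (subst prod.atLeast_Suc_atMost) auto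
  also have "(\<Prod>l\<in>{1..N}. expectation (Z l)) = (if i = j then 1 else 0)"
  proof (cases "i = j")
    case True
    then show ?thesis using expZ by simp
  next
    case False
    \<comment> \<open>Take l = i, or l = j when i = 0, since index 0 carries g(x) and not a
      zero-mean noise.\<close>
    have "\<exists>l\<in>{1..N}. expectation (Z l) = 0"
    proof (cases "i = 0")
      case True
      then show ?thesis using False ij expZ[of j] by (intro bexI[of _ j]) auto
    next
      case i: False
      then show ?thesis using False ij expZ[of i] by (intro bexI[of _ i]) auto
    qed
    then show ?thesis using False by simp
  qed
  finally show ?exp
    by (simp add: Z_def[abs_def] f_def)
qed

section \<open>The adjoint of the second-moment recursion\<close>

text \<open>The second-moment matrix S = E[x x^T] evolves forward by S -> \<Sum> A_i S A_i^T. This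
  is the adjoint of that map for the trace inner product, so it carries a weight matrix from time
  k+1 back to time k.\<close>

definition moment_adjoint :: "nat \<Rightarrow> (nat \<Rightarrow> nat \<Rightarrow> real^'n^'n) \<Rightarrow> nat \<Rightarrow> real^'n^'n \<Rightarrow> real^'n^'n" where
  "moment_adjoint N A k X = (\<Sum>i=0..N. transpose (A i k) ** X ** A i k)"

lemma sum_matrix_vector_mult:
  fixes f :: "'b \<Rightarrow> real^'n^'m"
  shows "sum f S *v x = (\<Sum>i\<in>S. f i *v x)"
  by (induction S rule: infinite_finite_induct) (auto simp: matrix_vector_mult_add_rdistrib)

lemma inner_transpose_matrix_vector:
  fixes A :: "real^'n^'m"
  shows "x \<bullet> (transpose A *v y) = (A *v x) \<bullet> y"
  by (metis dot_lmul_matrix inner_commute transpose_matrix_vector)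

text \<open>Two separate vectors are kept so that the identity also yields the symmetry of the
  iterates, beyond their quadratic forms.\<close>

lemma inner_moment_adjoint:
  "u \<bullet> (moment_adjoint N A k X *v v) = (\<Sum>i=0..N. (A i k *v u) \<bullet> (X *v (A i k *v v)))"
  unfolding moment_adjoint_def
  by (simp add: sum_matrix_vector_mult inner_sum_right inner_transpose_matrix_vector
      del: transpose_matrix_vector flip: matrix_vector_mul_assoc)

text \<open>In finite dimension linearity gives continuity, which lets the map act termwise on the
  series defining the Lyapunov matrix.\<close>

lemma linear_moment_adjoint: "linear (moment_adjoint N A k)"
proof (rule linearI)
  show "moment_adjoint N A k (X + Y) = moment_adjoint N A k X + moment_adjoint N A k Y" for X Y
    by (simp add: moment_adjoint_def matrix_matrix_mult_def vec_eq_iff sum.distrib sum_distrib_left algebra_simps)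
  show "moment_adjoint N A k (c *\<^sub>R X) = c *\<^sub>R moment_adjoint N A k X" for c X
    by (simp add: moment_adjoint_def matrix_matrix_mult_def vec_eq_iff sum_distrib_left sum_distrib_right mult_ac)
qed

section \<open>Bilinear forms of a square-integrable random vector\<close>

lemma abs_bilinear_matrix_le:
  fixes X B C :: "real^'n^'n"
  shows "\<exists>K. \<forall>v. \<bar>(B *v v) \<bullet> (X *v (C *v v))\<bar> \<le> K * (norm v)\<^sup>2"
proof (intro exI allI)
  fix v
  have "\<bar>(B *v v) \<bullet> ((X ** C) *v v)\<bar> \<le> norm (B *v v) * norm ((X ** C) *v v)"
    by (rule Cauchy_Schwarz_ineq2)
  also have "\<dots> \<le> (onorm ((*v) B) * norm v) * (onorm ((*v) (X ** C)) * norm v)"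
    by (intro mult_mono onorm[OF matrix_vector_mul_bounded_linear] mult_nonneg_nonneg onorm_pos_le
        matrix_vector_mul_bounded_linear) auto
  finally show "\<bar>(B *v v) \<bullet> (X *v (C *v v))\<bar> \<le> onorm ((*v) B) * onorm ((*v) (X ** C)) * (norm v)\<^sup>2"
    by (simp add: power2_eq_square mult_ac matrix_vector_mul_assoc)
qed

lemma measurable_bilinear_matrix:
  fixes X B C :: "real^'n^'n"
  shows "(\<lambda>v. (B *v v) \<bullet> (X *v (C *v v))) \<in> borel_measurable borel"
  unfolding matrix_vector_mul_assoc
  by (intro borel_measurable_continuous_onI continuous_on_inner linear_continuous_on
      matrix_vector_mul_bounded_linear)

lemma (in prob_space) integrable_bilinear_matrix:
  fixes X B C :: "real^'n^'n" and x :: "'a \<Rightarrow> real^'n"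
  assumes [measurable]: "x \<in> borel_measurable M" and "integrable M (\<lambda>\<omega>. (norm (x \<omega>))\<^sup>2)"
  shows "integrable M (\<lambda>\<omega>. (B *v x \<omega>) \<bullet> (X *v (C *v x \<omega>)))"
proof -
  obtain K where K: "\<And>v. \<bar>(B *v v) \<bullet> (X *v (C *v v))\<bar> \<le> K * (norm v)\<^sup>2"
    using abs_bilinear_matrix_le by blast
  show ?thesis
  proof (rule Bochner_Integration.integrable_bound)
    show "integrable M (\<lambda>\<omega>. K * (norm (x \<omega>))\<^sup>2)" using assms(2) by simp
    show "(\<lambda>\<omega>. (B *v x \<omega>) \<bullet> (X *v (C *v x \<omega>))) \<in> borel_measurable M"
      using measurable_compose[OF assms(1) measurable_bilinear_matrix] .
    show "AE \<omega> in M. norm ((B *v x \<omega>) \<bullet> (X *v (C *v x \<omega>))) \<le> norm (K * (norm (x \<omega>))\<^sup>2)"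
      using K by (intro AE_I2) (metis abs_ge_self order_trans real_norm_def)
  qed
qed

text \<open>Expanding the form gives a double sum over noise indices; the product moments leave only
  its diagonal, which is the quadratic form of \<open>moment_adjoint\<close>.\<close>

lemma (in prob_space) quadratic_form_step:
  fixes A :: "nat \<Rightarrow> nat \<Rightarrow> real^'n^'n" and X :: "real^'n^'n"
    and Y :: "nat \<Rightarrow> 'a \<Rightarrow> real" and x :: "'a \<Rightarrow> real^'n" and k :: nat
  assumes indep: "indep_with_vector M N Y x"
    and sq: "\<And>i. i \<in> {1..N} \<Longrightarrow> integrable M (\<lambda>\<omega>. (Y i \<omega>)\<^sup>2)"
    and mean: "\<And>i. i \<in> {1..N} \<Longrightarrow> expectation (Y i) = 0"
    and second: "\<And>i. i \<in> {1..N} \<Longrightarrow> expectation (\<lambda>\<omega>. (Y i \<omega>)\<^sup>2) = 1"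
    and int: "integrable M (\<lambda>\<omega>. (norm (x \<omega>))\<^sup>2)"
  defines "y \<equiv> \<lambda>\<omega>. A 0 k *v x \<omega> + (\<Sum>i=1..N. Y i \<omega> *\<^sub>R (A i k *v x \<omega>))"
  shows "integrable M (\<lambda>\<omega>. y \<omega> \<bullet> (X *v y \<omega>))" (is ?int)
    and "expectation (\<lambda>\<omega>. y \<omega> \<bullet> (X *v y \<omega>)) =
      expectation (\<lambda>\<omega>. x \<omega> \<bullet> (moment_adjoint N A k X *v x \<omega>))" (is ?exp)
proof -
  \<comment> \<open>With \<open>W 0 = 1\<close> the drift and the noise terms form one sum over
    0..N.\<close>
  define W where "W l \<omega> = (if l = 0 then 1 else Y l \<omega>)" for l :: nat and \<omega>
  define g where "g i j v = (A i k *v v) \<bullet> (X *v (A j k *v v))" for i j v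
  have xm: "x \<in> borel_measurable M"
    using indep unfolding indep_with_vector_def by blast
  have gm: "g i j \<in> borel_measurable borel" for i j
    unfolding g_def by (rule measurable_bilinear_matrix)
  have gint: "integrable M (\<lambda>\<omega>. g i j (x \<omega>))" for i j
    unfolding g_def by (rule integrable_bilinear_matrix[OF xm int])
  note moment = indep_with_vector_product_moment[OF indep sq mean second gm gint, folded W_def]
  have y: "y \<omega> = (\<Sum>i=0..N. W i \<omega> *\<^sub>R (A i k *v x \<omega>))" for \<omega>
    unfolding y_def
    by (subst sum.atLeast_Suc_atMost) (auto simp: W_def intro!: sum.cong)
  have expand: "y \<omega> \<bullet> (X *v y \<omega>) = (\<Sum>i=0..N. \<Sum>j=0..N. W i \<omega> * W j \<omega> * g i j (x \<omega>))" for \<omega>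
    unfolding y g_def inner_sum_left
    by (simp add: inner_sum_right linear_sum[OF matrix_vector_mul_linear]
        linear_scale[OF matrix_vector_mul_linear] sum_distrib_left mult_ac)
  show ?int
    unfolding expand by (intro Bochner_Integration.integrable_sum moment(1)) auto
  have "expectation (\<lambda>\<omega>. y \<omega> \<bullet> (X *v y \<omega>)) =
      (\<Sum>i=0..N. \<Sum>j=0..N. expectation (\<lambda>\<omega>. W i \<omega> * W j \<omega> * g i j (x \<omega>)))"
    unfolding expand
    by (subst Bochner_Integration.integral_sum;
        (intro Bochner_Integration.integrable_sum sum.cong refl Bochner_Integration.integral_sum moment(1))?) auto
  also have "\<dots> = (\<Sum>i=0..N. \<Sum>j=0..N. if i = j then expectation (\<lambda>\<omega>. g i j (x \<omega>)) else 0)"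
    by (intro sum.cong refl moment(2)) auto
  also have "\<dots> = (\<Sum>i=0..N. expectation (\<lambda>\<omega>. g i i (x \<omega>)))"
    by (simp add: sum.delta)
  also have "\<dots> = expectation (\<lambda>\<omega>. \<Sum>i=0..N. g i i (x \<omega>))"
    by (rule Bochner_Integration.integral_sum[symmetric]) (rule gint)
  also have "\<dots> = expectation (\<lambda>\<omega>. x \<omega> \<bullet> (moment_adjoint N A k X *v x \<omega>))"
    by (simp add: inner_moment_adjoint g_def)
  finally show ?exp .
qed

text \<open>The outermost map belongs to the earliest time k, because weights travel backward; hence
  the inner iterate starts at \<open>Suc k\<close>.\<close>

primrec moment_iter :: "nat \<Rightarrow> (nat \<Rightarrow> nat \<Rightarrow> real^'n^'n) \<Rightarrow> nat \<Rightarrow> nat \<Rightarrow> real^'n^'n" where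
  "moment_iter N A 0 k = mat 1"
| "moment_iter N A (Suc j) k = moment_adjoint N A k (moment_iter N A j (Suc k))"

lemma symmetric_moment_iter: "u \<bullet> (moment_iter N A j k *v v) = (moment_iter N A j k *v u) \<bullet> v"
proof (induction j arbitrary: k u v)
  case (Suc j)
  have "u \<bullet> (moment_iter N A (Suc j) k *v v) = v \<bullet> (moment_iter N A (Suc j) k *v u)"
    unfolding moment_iter.simps inner_moment_adjoint
    by (intro sum.cong refl) (metis Suc inner_commute)
  then show ?case by (simp only: inner_commute)
qed simp

section \<open>Matrix series\<close>

lemma transpose_eq_iff_inner:
  fixes X :: "real^'n^'n"
  shows "transpose X = X \<longleftrightarrow> (\<forall>u v. u \<bullet> (X *v v) = (X *v u) \<bullet> v)"
proof
  assume "transpose X = X"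
  then show "\<forall>u v. u \<bullet> (X *v v) = (X *v u) \<bullet> v"
    by (metis inner_transpose_matrix_vector)
next
  assume *: "\<forall>u v. u \<bullet> (X *v v) = (X *v u) \<bullet> v"
  have "transpose X *v v = X *v v" for v
    by (rule vector_eq_ldot[THEN iffD1]) (simp add: * inner_transpose_matrix_vector del: transpose_matrix_vector)
  then show "transpose X = X"
    by (simp add: matrix_eq del: transpose_matrix_vector)
qed

text \<open>Polarisation recovers the entries of a symmetric matrix from its quadratic form, and the
  norm is at most the sum of the absolute values of the entries. Decay of quadratic forms thus
  becomes norm summability of matrices.\<close>

lemma norm_matrix_le_quadratic_form:
  fixes X :: "real^'n^'n"
  assumes sym: "\<And>u v. u \<bullet> (X *v v) = (X *v u) \<bullet> v"
    and le: "\<And>v. \<bar>v \<bullet> (X *v v)\<bar> \<le> c * (norm v)\<^sup>2"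
  shows "norm X \<le> (real CARD('n))\<^sup>2 * (2 * c)"
proof -
  have c: "0 \<le> c"
    using le[of "axis undefined 1"] by simp
  \<comment> \<open>Four times the entry is a difference of two form values at vectors of norm at
    most 2, each at most 4c in absolute value; this gives 8c / 4.\<close>
  have entry: "\<bar>X $ a $ b\<bar> \<le> 2 * c" for a b
  proof -
    let ?u = "axis a (1::real)" and ?v = "axis b (1::real)"
    have "X $ a $ b = ?u \<bullet> (X *v ?v)"
      by (simp add: matrix_vector_mult_basis column_def inner_axis')
    moreover have "4 * (?u \<bullet> (X *v ?v)) = (?u + ?v) \<bullet> (X *v (?u + ?v)) - (?u - ?v) \<bullet> (X *v (?u - ?v))"
      using sym[of ?v ?u]
      by (simp add: matrix_vector_right_distrib matrix_vector_mult_diff_distrib inner_diff inner_add inner_commute)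
    moreover have "norm (?u + ?v) \<le> 2" "norm (?u - ?v) \<le> 2"
      using norm_triangle_ineq[of ?u ?v] norm_triangle_ineq4[of ?u ?v] by simp_all
    then have "c * (norm (?u + ?v))\<^sup>2 \<le> c * 2\<^sup>2" "c * (norm (?u - ?v))\<^sup>2 \<le> c * 2\<^sup>2"
      using c by (meson mult_left_mono norm_ge_zero power_mono)+
    ultimately show ?thesis
      using le[of "?u + ?v"] le[of "?u - ?v"] by simp
  qed
  have "norm X \<le> (\<Sum>a\<in>UNIV. norm (X $ a))"
    by (simp add: norm_vec_def L2_set_le_sum)
  also have "\<dots> \<le> (\<Sum>a\<in>UNIV. \<Sum>b\<in>UNIV. \<bar>X $ a $ b\<bar>)"
    by (intro sum_mono norm_le_l1_cart)
  also have "\<dots> \<le> (\<Sum>a\<in>(UNIV::'n set). \<Sum>b\<in>(UNIV::'n set). 2 * c)"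
    by (intro sum_mono entry)
  finally show ?thesis
    by (simp add: power2_eq_square)
qed

lemma bounded_linear_inner_matrix_vector:
  fixes u v :: "real^'n"
  shows "bounded_linear (\<lambda>X::real^'n^'n. u \<bullet> (X *v v))"
proof -
  have "linear (\<lambda>X::real^'n^'n. u \<bullet> (X *v v))"
    by (rule linearI)
      (simp_all add: matrix_vector_mult_add_rdistrib inner_right_distrib flip: scaleR_matrix_vector_assoc)
  then show ?thesis by (rule linear_conv_bounded_linear[THEN iffD1])
qed

section \<open>Lyapunov characterisation of mean-square stability\<close>

text \<open>The noise enters through its first two moments, so the variance condition is recorded as
  a unit second moment.\<close>

locale multiplicative_noise = prob_space M for M :: "'w measure" +
  fixes N :: nat and A :: "nat \<Rightarrow> nat \<Rightarrow> real^'n^'n" and \<nu> :: "nat \<Rightarrow> nat \<Rightarrow> 'w \<Rightarrow> real"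
  assumes independent: "\<And>k0 x0 k. k0 \<le> k \<Longrightarrow>
      indep_with_vector M N (\<lambda>i. \<nu> i k) (state N A \<nu> k0 x0 k)"
    and square_integrable: "\<And>i k. i \<in> {1..N} \<Longrightarrow> integrable M (\<lambda>\<omega>. (\<nu> i k \<omega>)\<^sup>2)"
    and zero_mean: "\<And>i k. i \<in> {1..N} \<Longrightarrow> expectation (\<nu> i k) = 0"
    and unit_second_moment: "\<And>i k. i \<in> {1..N} \<Longrightarrow> expectation (\<lambda>\<omega>. (\<nu> i k \<omega>)\<^sup>2) = 1"
begin

text \<open>The one-step result with X = I passes square integrability from k to k+1, starting from
  a constant state.\<close>

lemma integrable_norm_state:
  assumes "k0 \<le> k"
  shows "integrable M (\<lambda>\<omega>. (norm (state N A \<nu> k0 x0 k \<omega>))\<^sup>2)"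
  using assms
proof (induction k rule: dec_induct)
  case base
  then show ?case by (simp add: state_initial)
next
  case (step k)
  from quadratic_form_step(1)[where X="mat 1" and A=A and k=k, OF independent[OF step.hyps(1)] square_integrable
      zero_mean unit_second_moment step.IH]
  show ?case using step.hyps by (simp add: power2_norm_eq_inner)
qed

lemma integrable_quadratic_state:
  assumes "k0 \<le> k"
  shows "integrable M (\<lambda>\<omega>. state N A \<nu> k0 x0 k \<omega> \<bullet> (X *v state N A \<nu> k0 x0 k \<omega>))"
proof -
  have "state N A \<nu> k0 x0 k \<in> borel_measurable M"
    using independent[OF assms] unfolding indep_with_vector_def by blast
  from integrable_bilinear_matrix[OF this integrable_norm_state[OF assms], of "mat 1" X "mat 1"]
  show ?thesis by simp
qed

lemma expectation_quadratic_state_Suc: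
  assumes "k0 \<le> k"
  shows "expectation (\<lambda>\<omega>. state N A \<nu> k0 x0 (Suc k) \<omega> \<bullet> (X *v state N A \<nu> k0 x0 (Suc k) \<omega>)) =
    expectation (\<lambda>\<omega>. state N A \<nu> k0 x0 k \<omega> \<bullet> (moment_adjoint N A k X *v state N A \<nu> k0 x0 k \<omega>))"
  using quadratic_form_step(2)[where X=X and A=A and k=k, OF independent[OF assms] square_integrable
      zero_mean unit_second_moment integrable_norm_state[OF assms]] assms
  by simp

text \<open>This links probability and matrices: the forms of the iterates inherit non-negativity
  and decay from the second moments of the state.\<close>

lemma expectation_norm_state:
  "expectation (\<lambda>\<omega>. (norm (state N A \<nu> k x0 (k + j) \<omega>))\<^sup>2) = x0 \<bullet> (moment_iter N A j k *v x0)"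
proof -
  \<comment> \<open>Allowing a start \<open>k0\<close> before k lets the induction advance k along
    one fixed trajectory. Setting \<open>k0 = k\<close> afterwards makes the state at time k
    deterministic.\<close>
  have "expectation (\<lambda>\<omega>. (norm (state N A \<nu> k0 x0 (k + j) \<omega>))\<^sup>2) =
    expectation (\<lambda>\<omega>. state N A \<nu> k0 x0 k \<omega> \<bullet> (moment_iter N A j k *v state N A \<nu> k0 x0 k \<omega>))"
    if "k0 \<le> k" for k0 k
    using that
  proof (induction j arbitrary: k)
    case 0
    then show ?case by (simp add: power2_norm_eq_inner)
  next
    case (Suc j)
    have "expectation (\<lambda>\<omega>. (norm (state N A \<nu> k0 x0 (Suc k + j) \<omega>))\<^sup>2) =
      expectation (\<lambda>\<omega>. state N A \<nu> k0 x0 (Suc k) \<omega> \<bullet>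
        (moment_iter N A j (Suc k) *v state N A \<nu> k0 x0 (Suc k) \<omega>))"
      using Suc by (intro Suc.IH) simp
    also note expectation_quadratic_state_Suc[OF Suc.prems]
    finally show ?case by simp
  qed
  from this[of k k] show ?thesis
    by (simp add: state_initial prob_space)
qed

text \<open>The series of iterates is a Neumann series: applying the adjoint map at time k to P(k+1)
  shifts it by one term, so it reproduces P(k) without its leading term I.\<close>

lemma stable_imp_lyapunov:
  assumes "unif_exp_ms_stable M N A \<nu>"
  obtains P \<alpha> where "1 \<le> \<alpha>" "\<And>k. transpose (P k) = P k"
    "\<And>k v. (norm v)\<^sup>2 \<le> v \<bullet> (P k *v v)" "\<And>k v. v \<bullet> (P k *v v) \<le> \<alpha> * (norm v)\<^sup>2"
    "\<And>k. moment_adjoint N A k (P (Suc k)) - P k = - mat 1"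
proof -
  obtain \<rho> \<beta> :: real where \<rho>: "0 \<le> \<rho>" "\<rho> < 1" and \<beta>: "1 < \<beta>"
    and decay: "\<And>k0 k x0. k0 \<le> k \<Longrightarrow> expectation (\<lambda>\<omega>. (norm (state N A \<nu> k0 x0 k \<omega>))\<^sup>2)
            \<le> \<beta> * \<rho> ^ (k - k0) * expectation (\<lambda>\<omega>. (norm x0)\<^sup>2)"
    using assms unfolding unif_exp_ms_stable_def by blast
  define S where "S = moment_iter N A"
  have S_le: "v \<bullet> (S j k *v v) \<le> \<beta> * \<rho> ^ j * (norm v)\<^sup>2" for j k v
    using decay[of k "k + j" v] by (simp add: expectation_norm_state S_def prob_space)
  have S_ge: "0 \<le> v \<bullet> (S j k *v v)" for j k v
    unfolding S_def expectation_norm_state[symmetric] by simp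
  have S_sym: "u \<bullet> (S j k *v v) = (S j k *v u) \<bullet> v" for u v j k
    unfolding S_def by (rule symmetric_moment_iter)
  have geo: "summable (\<lambda>j. \<rho> ^ j)"
    using \<rho> by simp
  have sum_S: "summable (\<lambda>j. S j k)" for k
  proof (rule summable_comparison_test')
    show "summable (\<lambda>j. (real CARD('n))\<^sup>2 * (2 * (\<beta> * \<rho> ^ j)))"
      by (intro summable_mult geo)
    show "norm (S j k) \<le> (real CARD('n))\<^sup>2 * (2 * (\<beta> * \<rho> ^ j))" for j
      by (rule norm_matrix_le_quadratic_form) (use S_sym S_ge S_le in auto)
  qed
  define P where "P k = (\<Sum>j. S j k)" for k
  have sums: "(\<lambda>j. u \<bullet> (S j k *v v)) sums (u \<bullet> (P k *v v))" for u v k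
    unfolding P_def
    by (rule bounded_linear.sums[OF bounded_linear_inner_matrix_vector summable_sums[OF sum_S]])
  show thesis
  proof
    \<comment> \<open>The upper constant is the sum of the geometric majorant with terms
      \<open>\<beta> * \<rho> ^ j\<close>.\<close>
    show "1 \<le> \<beta> / (1 - \<rho>)"
      using \<rho> \<beta> by (simp add: field_simps)
    show "transpose (P k) = P k" for k
      unfolding transpose_eq_iff_inner
    proof (intro allI)
      fix u v
      have "v \<bullet> (S j k *v u) = u \<bullet> (S j k *v v)" for j
        using S_sym[of v j k u] by (simp only: inner_commute)
      then have "(\<lambda>j. u \<bullet> (S j k *v v)) sums (v \<bullet> (P k *v u))"
        using sums[of v k u] by simp
      from sums_unique2[OF sums this] show "u \<bullet> (P k *v v) = (P k *v u) \<bullet> v"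
        by (simp only: inner_commute)
    qed
    \<comment> \<open>Only the term j = 0, which is the identity, is kept; the other terms are
      non-negative.\<close>
    show "(norm v)\<^sup>2 \<le> v \<bullet> (P k *v v)" for k v
      using sum_le_suminf[OF sums_summable[OF sums[of v k v]], of "{0}"] S_ge sums_unique[OF sums[of v k v]]
      by (simp add: S_def power2_norm_eq_inner)
    show "v \<bullet> (P k *v v) \<le> \<beta> / (1 - \<rho>) * (norm v)\<^sup>2" for k v
    proof (rule sums_le[OF S_le sums])
      show "(\<lambda>j. \<beta> * \<rho> ^ j * (norm v)\<^sup>2) sums (\<beta> / (1 - \<rho>) * (norm v)\<^sup>2)"
        using sums_mult2[OF sums_mult[OF geometric_sums[of \<rho>], of \<beta>], of "(norm v)\<^sup>2"] \<rho> by simp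
    qed
    show "moment_adjoint N A k (P (Suc k)) - P k = - mat 1" for k
    proof -
      have "moment_adjoint N A k (P (Suc k)) = (\<Sum>j. moment_adjoint N A k (S j (Suc k)))"
        unfolding P_def
        by (rule bounded_linear.suminf[OF linear_conv_bounded_linear[THEN iffD1, OF linear_moment_adjoint] sum_S])
      also have "\<dots> = (\<Sum>j. S (Suc j) k)"
        by (simp add: S_def)
      also have "\<dots> = P k - mat 1"
        unfolding P_def by (subst suminf_split_head[OF sum_S]) (simp add: S_def)
      finally show ?thesis by simp
    qed
  qed
qed

text \<open>The function x^T P(k) x is a stochastic Lyapunov function. The upper bound on P controls
  both its contraction rate and its initial value, and the lower bound converts its decay into decay
  of the squared norm.\<close>

lemma lyapunov_imp_stable:
  assumes pos: "0 < a" "0 < b" "0 < c"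
    and lower: "\<And>k v. a * (norm v)\<^sup>2 \<le> v \<bullet> (P k *v v)"
    and upper: "\<And>k v. v \<bullet> (P k *v v) \<le> b * (norm v)\<^sup>2"
    and decrease: "\<And>k v. v \<bullet> (moment_adjoint N A k (P (Suc k)) *v v) \<le> v \<bullet> (P k *v v) - c * (norm v)\<^sup>2"
  shows "unif_exp_ms_stable M N A \<nu>"
proof -
  \<comment> \<open>The truncation at 0 spares a proof of \<open>c \<le> b\<close>.\<close>
  define \<rho> where "\<rho> = max 0 (1 - c / b)"
  have \<rho>: "0 \<le> \<rho>" "\<rho> < 1"
    using pos by (auto simp: \<rho>_def)
  \<comment> \<open>The upper bound gives c |v|^2 \<ge> (c/b) v^T P(k) v, which turns the additive
    decrease into a multiplicative one.\<close>
  have contract: "v \<bullet> (moment_adjoint N A k (P (Suc k)) *v v) \<le> \<rho> * (v \<bullet> (P k *v v))" for k v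
  proof -
    let ?p = "v \<bullet> (P k *v v)"
    have "0 \<le> ?p"
      using lower[of v k] pos by (meson mult_nonneg_nonneg less_imp_le order_trans zero_le_power2)
    then have "(1 - c / b) * ?p \<le> \<rho> * ?p"
      by (intro mult_right_mono) (auto simp: \<rho>_def)
    moreover have "c / b * ?p \<le> c * (norm v)\<^sup>2"
      using mult_left_mono[OF upper[of v k], of "c / b"] pos by simp
    ultimately show ?thesis
      using decrease[of v k] by (simp add: algebra_simps)
  qed
  have V: "expectation (\<lambda>\<omega>. state N A \<nu> k0 x0 k \<omega> \<bullet> (P k *v state N A \<nu> k0 x0 k \<omega>))
      \<le> \<rho> ^ (k - k0) * (x0 \<bullet> (P k0 *v x0))" (is "?V k \<le> _") if "k0 \<le> k" for k0 k x0
    using that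
  proof (induction k rule: dec_induct)
    case base
    then show ?case by (simp add: state_initial prob_space)
  next
    case (step k)
    have "?V (Suc k) \<le> expectation (\<lambda>\<omega>. \<rho> * (state N A \<nu> k0 x0 k \<omega> \<bullet> (P k *v state N A \<nu> k0 x0 k \<omega>)))"
      unfolding expectation_quadratic_state_Suc[OF step.hyps(1)]
      by (intro integral_mono integrable_mult_right integrable_quadratic_state step.hyps contract)
    also have "\<dots> = \<rho> * ?V k"
      by simp
    also have "\<dots> \<le> \<rho> * (\<rho> ^ (k - k0) * (x0 \<bullet> (P k0 *v x0)))"
      by (intro mult_left_mono step.IH \<rho>)
    finally show ?case
      using step.hyps by (simp add: Suc_diff_le mult.assoc)
  qed
  show ?thesis
    unfolding unif_exp_ms_stable_def
  \<comment> \<open>The estimate yields the factor b/a; the added 1 makes the constant exceed 1, as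
    the definition of stability demands.\<close>
  proof (rule exI[of _ \<rho>], rule exI[of _ "b / a + 1"], intro conjI allI impI)
    fix k0 k :: nat and x0 :: "real^'n"
    assume k: "k0 \<le> k"
    show "integrable M (\<lambda>\<omega>. (norm (state N A \<nu> k0 x0 k \<omega>))\<^sup>2)"
      by (rule integrable_norm_state[OF k])
    have "a * expectation (\<lambda>\<omega>. (norm (state N A \<nu> k0 x0 k \<omega>))\<^sup>2) =
        expectation (\<lambda>\<omega>. a * (norm (state N A \<nu> k0 x0 k \<omega>))\<^sup>2)"
      by simp
    also have "\<dots> \<le> expectation (\<lambda>\<omega>. state N A \<nu> k0 x0 k \<omega> \<bullet> (P k *v state N A \<nu> k0 x0 k \<omega>))"
      by (intro integral_mono integrable_mult_right integrable_norm_state integrable_quadratic_state k lower)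
    also have "\<dots> \<le> \<rho> ^ (k - k0) * (x0 \<bullet> (P k0 *v x0))"
      by (rule V[OF k])
    also have "\<dots> \<le> \<rho> ^ (k - k0) * (b * (norm x0)\<^sup>2)"
      by (intro mult_left_mono upper zero_le_power \<rho>)
    also have "\<dots> \<le> a * ((b / a + 1) * \<rho> ^ (k - k0) * (norm x0)\<^sup>2)"
      using pos \<rho> by (simp add: field_simps)
    finally show "expectation (\<lambda>\<omega>. (norm (state N A \<nu> k0 x0 k \<omega>))\<^sup>2)
        \<le> (b / a + 1) * \<rho> ^ (k - k0) * expectation (\<lambda>\<omega>. (norm x0)\<^sup>2)"
      using pos by (simp add: prob_space)
  qed (use \<rho> pos in auto)
qed

end

section \<open>Loewner bounds as quadratic form bounds, and the equivalence\<close>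

lemma inner_scaleR_mat_1: "v \<bullet> ((c *\<^sub>R mat 1) *v v) = c * (norm (v :: real^'n))\<^sup>2"
  by (simp add: power2_norm_eq_inner flip: scaleR_matrix_vector_assoc)

lemma scaleR_mat_1_loewner_le_iff:
  assumes "transpose X = X"
  shows "c *\<^sub>R mat 1 \<preceq>\<^sub>L X \<longleftrightarrow> (\<forall>v. c * (norm v)\<^sup>2 \<le> v \<bullet> (X *v v))"
    and "X \<preceq>\<^sub>L c *\<^sub>R mat 1 \<longleftrightarrow> (\<forall>v. v \<bullet> (X *v v) \<le> c * (norm v)\<^sup>2)"
proof -
  have "transpose (X - c *\<^sub>R mat 1) = X - c *\<^sub>R mat 1" "transpose (c *\<^sub>R mat 1 - X) = c *\<^sub>R mat 1 - X"
    using assms by (auto simp: transpose_def vec_eq_iff mat_def)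
  then show "c *\<^sub>R mat 1 \<preceq>\<^sub>L X \<longleftrightarrow> (\<forall>v. c * (norm v)\<^sup>2 \<le> v \<bullet> (X *v v))"
    and "X \<preceq>\<^sub>L c *\<^sub>R mat 1 \<longleftrightarrow> (\<forall>v. v \<bullet> (X *v v) \<le> c * (norm v)\<^sup>2)"
    unfolding loewner_le_def possemidef_def
    by (simp_all add: matrix_vector_mult_diff_rdistrib inner_diff_right inner_scaleR_mat_1)
qed

theorem theorem4p8:
  fixes M :: "'w measure"
    and N :: nat
    and A :: "nat \<Rightarrow> nat \<Rightarrow> real^'n^'n"
    and \<nu> :: "nat \<Rightarrow> nat \<Rightarrow> 'w \<Rightarrow> real"
  assumes "prob_space M"
    and bounded: "\<And>i. i \<le> N \<Longrightarrow> bounded (range (A i))"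
    and random_variable: "\<And>i k. i \<in> {1..N} \<Longrightarrow> \<nu> i k \<in> borel_measurable M"
    and stationary: "\<And>i. i \<in> {1..N} \<Longrightarrow> stationary M (\<nu> i)"
    and independent: "\<And>k0 x0 k. k0 \<le> k \<Longrightarrow>
           indep_with_vector M N (\<lambda>i. \<nu> i k) (state N A \<nu> k0 x0 k)"
    and square_integrable: "\<And>i k. i \<in> {1..N} \<Longrightarrow> integrable M (\<lambda>\<omega>. (\<nu> i k \<omega>)\<^sup>2)"
    and zero_mean: "\<And>i k. i \<in> {1..N} \<Longrightarrow> prob_space.expectation M (\<nu> i k) = 0"
    and unit_variance: "\<And>i k. i \<in> {1..N} \<Longrightarrow> prob_space.variance M (\<nu> i k) = 1"
  shows "unif_exp_ms_stable M N A \<nu> \<longleftrightarrow>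
    (\<exists>(P :: nat \<Rightarrow> real^'n^'n) (Q :: nat \<Rightarrow> real^'n^'n) \<alpha>\<^sub>1 \<alpha>\<^sub>2 \<beta>\<^sub>1 \<beta>\<^sub>2.
       (\<forall>k. posdef (P k) \<and> posdef (Q k)) \<and>
       0 < \<alpha>\<^sub>1 \<and> 0 < \<alpha>\<^sub>2 \<and> 0 < \<beta>\<^sub>1 \<and> 0 < \<beta>\<^sub>2 \<and>
       (\<forall>k. \<alpha>\<^sub>1 *\<^sub>R mat 1 \<preceq>\<^sub>L P k \<and> P k \<preceq>\<^sub>L \<alpha>\<^sub>2 *\<^sub>R mat 1 \<and>
            \<beta>\<^sub>1 *\<^sub>R mat 1 \<preceq>\<^sub>L Q k \<and> Q k \<preceq>\<^sub>L \<beta>\<^sub>2 *\<^sub>R mat 1 \<and>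
            (\<Sum>i=0..N. transpose (A i k) ** P (k + 1) ** A i k) - P k = - Q k))"
proof -
  interpret prob_space M by fact
  interpret multiplicative_noise M N A \<nu>
  proof
    show "expectation (\<lambda>\<omega>. (\<nu> i k \<omega>)\<^sup>2) = 1" if "i \<in> {1..N}" for i k
      using unit_variance[OF that] zero_mean[OF that] by simp
  qed (fact independent square_integrable zero_mean)+
  show ?thesis (is "_ \<longleftrightarrow> ?lyapunov")
  proof
    assume "unif_exp_ms_stable M N A \<nu>"
    then obtain P \<alpha> where \<alpha>: "1 \<le> \<alpha>" and sym: "\<And>k. transpose (P k) = P k"
      and lower: "\<And>k v. (norm v)\<^sup>2 \<le> v \<bullet> (P k *v v)"
      and upper: "\<And>k v. v \<bullet> (P k *v v) \<le> \<alpha> * (norm v)\<^sup>2"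
      and eq: "\<And>k. moment_adjoint N A k (P (Suc k)) - P k = - mat 1"
      by (rule stable_imp_lyapunov) blast
    have "posdef (P k)" for k
      unfolding posdef_def using sym lower by (metis order_less_le_trans zero_less_norm_iff zero_less_power)
    moreover have "posdef (mat 1 :: real^'n^'n)"
      by (simp add: posdef_def transpose_mat)
    moreover have "1 *\<^sub>R mat 1 \<preceq>\<^sub>L P k" "P k \<preceq>\<^sub>L \<alpha> *\<^sub>R mat 1" for k
      unfolding scaleR_mat_1_loewner_le_iff[OF sym] using lower upper by simp_all
    moreover have "1 *\<^sub>R mat 1 \<preceq>\<^sub>L (mat 1 :: real^'n^'n)" "(mat 1 :: real^'n^'n) \<preceq>\<^sub>L 1 *\<^sub>R mat 1"
      unfolding scaleR_mat_1_loewner_le_iff[OF transpose_mat] by (simp_all add: power2_norm_eq_inner)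
    moreover have "(\<Sum>i=0..N. transpose (A i k) ** P (k + 1) ** A i k) - P k = - mat 1" for k
      using eq[of k] by (simp add: moment_adjoint_def)
    \<comment> \<open>The witness for Q is the constant identity, with lower bound 1 for P and both
      bounds 1 for Q; \<open>1 \<le> \<alpha>\<close> makes the remaining constant positive.\<close>
    ultimately show ?lyapunov
      using \<alpha>
      by - (rule exI[of _ P], rule exI[of _ "\<lambda>_. mat 1"], rule exI[of _ 1], rule exI[of _ \<alpha>],
          rule exI[of _ 1], rule exI[of _ 1], simp)
  next
    assume ?lyapunov
    then obtain P Q :: "nat \<Rightarrow> real^'n^'n" and a b c d :: real
      where pd: "\<And>k. posdef (P k)" "\<And>k. posdef (Q k)" and pos: "0 < a" "0 < b" "0 < c"
        and P: "\<And>k. a *\<^sub>R mat 1 \<preceq>\<^sub>L P k" "\<And>k. P k \<preceq>\<^sub>L b *\<^sub>R mat 1"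
        and Q: "\<And>k. c *\<^sub>R mat 1 \<preceq>\<^sub>L Q k"
        and eq: "\<And>k. moment_adjoint N A k (P (Suc k)) - P k = - Q k"
      unfolding moment_adjoint_def Suc_eq_plus1 by blast
    have sym: "transpose (P k) = P k" "transpose (Q k) = Q k" for k
      using pd by (auto simp: posdef_def)
    show "unif_exp_ms_stable M N A \<nu>"
    proof (rule lyapunov_imp_stable[OF pos])
      show "a * (norm v)\<^sup>2 \<le> v \<bullet> (P k *v v)" "v \<bullet> (P k *v v) \<le> b * (norm v)\<^sup>2" for k v
        using P unfolding scaleR_mat_1_loewner_le_iff[OF sym(1)] by simp_all
      show "v \<bullet> (moment_adjoint N A k (P (Suc k)) *v v) \<le> v \<bullet> (P k *v v) - c * (norm v)\<^sup>2" for k v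
      proof -
        have "moment_adjoint N A k (P (Suc k)) = P k - Q k"
          using eq[of k] by (simp add: algebra_simps)
        moreover have "c * (norm v)\<^sup>2 \<le> v \<bullet> (Q k *v v)"
          using Q unfolding scaleR_mat_1_loewner_le_iff[OF sym(2)] by simp
        ultimately show ?thesis
          by (simp add: matrix_vector_mult_diff_rdistrib inner_diff_right)
      qed
    qed
  qed
qed

end
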